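(* Let $\langle\mathbb{A},\Rightarrow\!\!>,\Rightarrow,[\top,\top]\rangle$ be an IBCI-algebra obtained from $\langle A,\rightarrow,\top\rangle$, and write $X\precsim Y$ iff $X\Rightarrow Y=[\top,\top]$. For all $X,Y,Z\in\mathbb{A}$ and all degenerate intervals $X_d=[u,u]$, $Z_d=[w,w]$ ($u,w\in A$): (1) $[\top,\top]\precsim X$ implies $X=[\top,\top]$; (2) $X\precsim Y$ implies $Y\Rightarrow\!\!> Z\precsim X\Rightarrow\!\!> Z$; (3) $X\precsim Y$ implies $Z\Rightarrow\!\!> X\precsim Z\Rightarrow\!\!> Y$; (4) $X\precsim Y$ and $Y\precsim Z$ imply $X\precsim Z$; (5) $X\precsim Y\Rightarrow\!\!> Z_d$ implies $Y\precsim X\Rightarrow\!\!> Z_d$; (6) $X\Rightarrow\!\!> Y\precsim(Z_d\Rightarrow\!\!> X)\Rightarrow\!\!>(Z_d\Rightarrow\!\!> Y)$; (7) $((Y\Rightarrow\!\!> X_d)\Rightarrow\!\!> X_d)\Rightarrow\!\!> X_d=Y\Rightarrow\!\!> X_d$; (8) $X\Rightarrow\!\!> Y\precsim(Y\Rightarrow\!\!> X)\Rightarrow\!\!>[\top,\top]$; (9) $(X\Rightarrow\!\!> Y)\Rightarrow\!\!>[\top,\top]=(X\Rightarrow\!\!>[\top,\top])\Rightarrow\!\!>(Y\Rightarrow\!\!>[\top,\top])$.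
   Context: A BCI-algebra is a structure $\langle A,\rightarrow,\top\rangle$ such that for all $x,y,z\in A$: (C1) $(y\rightarrow z)\rightarrow((z\rightarrow x)\rightarrow(y\rightarrow x))=\top$; (C2) $x\rightarrow((x\rightarrow y)\rightarrow y)=\top$; (C3) $x\rightarrow x=\top$; (C4) $x\rightarrow y=\top$ and $y\rightarrow x=\top$ imply $x=y$; its induced order is $x\preceq y$ iff $x\rightarrow y=\top$. Given such an algebra with $\langle A,\preceq\rangle$ a meet-semilattice and $x\rightarrow(y\wedge z)=(x\rightarrow y)\wedge(x\rightarrow z)$ for all $x,y,z$, let $\mathbb{A}=\{[a,b]:a,b\in A,\ a\preceq b\}$, $\underline{[a,b]}=a$, $\overline{[a,b]}=b$; an interval is degenerate if $\underline X=\overline X$. Define $X\Rightarrow\!\!> Y=[\overline{X}\rightarrow\underline{Y},\ \underline{X}\rightarrow\overline{Y}]$ and $X\Rightarrow Y=[(\underline{X}\rightarrow\underline{Y})\wedge(\overline{X}\rightarrow\overline{Y}),\ \underline{X}\rightarrow\overline{Y}]$; $\langle\mathbb{A},\Rightarrow\!\!>,\Rightarrow,[\top,\top]\rangle$ is the IBCI-algebra. *)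

theory Defs
  imports "HOL-Algebra.Lattice"
begin

record 'a bci = "'a partial_object" +
  bci_imp :: "'a \<Rightarrow> 'a \<Rightarrow> 'a"  (infixr \<open>\<leadsto>\<index>\<close> 65)
  bci_top :: "'a"  (\<open>\<^bold>\<top>\<index>\<close>)

locale bci_algebra =
  fixes G (structure)
  assumes imp_closed: "\<lbrakk>x \<in> carrier G; y \<in> carrier G\<rbrakk> \<Longrightarrow> x \<leadsto> y \<in> carrier G"
    and top_closed: "\<^bold>\<top> \<in> carrier G"
    and C1: "\<lbrakk>x \<in> carrier G; y \<in> carrier G; z \<in> carrier G\<rbrakk>
               \<Longrightarrow> (y \<leadsto> z) \<leadsto> ((z \<leadsto> x) \<leadsto> (y \<leadsto> x)) = \<^bold>\<top>"
    and C2: "\<lbrakk>x \<in> carrier G; y \<in> carrier G\<rbrakk> \<Longrightarrow> x \<leadsto> ((x \<leadsto> y) \<leadsto> y) = \<^bold>\<top>"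
    and C3: "x \<in> carrier G \<Longrightarrow> x \<leadsto> x = \<^bold>\<top>"
    and C4: "\<lbrakk>x \<in> carrier G; y \<in> carrier G; x \<leadsto> y = \<^bold>\<top>; y \<leadsto> x = \<^bold>\<top>\<rbrakk> \<Longrightarrow> x = y"

definition bci_le :: "('a, 'b) bci_scheme \<Rightarrow> 'a \<Rightarrow> 'a \<Rightarrow> bool"  (infix \<open>\<preceq>\<index>\<close> 50)
  where "x \<preceq>\<^bsub>G\<^esub> y \<longleftrightarrow> x \<leadsto>\<^bsub>G\<^esub> y = \<^bold>\<top>\<^bsub>G\<^esub>"

definition bci_order :: "('a, 'b) bci_scheme \<Rightarrow> 'a gorder"
  where "bci_order G = \<lparr>carrier = carrier G, eq = (=), le = bci_le G\<rparr>"

definition bci_meet :: "('a, 'b) bci_scheme \<Rightarrow> 'a \<Rightarrow> 'a \<Rightarrow> 'a"  (infixl \<open>\<^bold>\<and>\<index>\<close> 70)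
  where "x \<^bold>\<and>\<^bsub>G\<^esub> y = x \<sqinter>\<^bsub>bci_order G\<^esub> y"

locale meet_bci_algebra = bci_algebra +
  assumes meet_semilattice: "lower_semilattice (bci_order G)"
    and imp_meet_distrib: "\<lbrakk>x \<in> carrier G; y \<in> carrier G; z \<in> carrier G\<rbrakk>
               \<Longrightarrow> x \<leadsto> (y \<^bold>\<and> z) = (x \<leadsto> y) \<^bold>\<and> (x \<leadsto> z)"

text \<open>The interval \<open>[a, b]\<close> is represented by the pair \<open>(a, b)\<close> of its endpoints, which
  determine it uniquely since the induced order is antisymmetric; \<open>(u, u)\<close> is a degenerate
  interval.\<close>

definition intervals :: "('a, 'b) bci_scheme \<Rightarrow> ('a \<times> 'a) set"
  where "intervals G = {(a, b). a \<in> carrier G \<and> b \<in> carrier G \<and> a \<preceq>\<^bsub>G\<^esub> b}"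

abbreviation lower :: "'a \<times> 'a \<Rightarrow> 'a"
  where "lower \<equiv> fst"

abbreviation upper :: "'a \<times> 'a \<Rightarrow> 'a"
  where "upper \<equiv> snd"

definition interval_top :: "('a, 'b) bci_scheme \<Rightarrow> 'a \<times> 'a"  (\<open>\<^bold>\<top>\<^bold>\<top>\<index>\<close>)
  where "\<^bold>\<top>\<^bold>\<top>\<^bsub>G\<^esub> = (\<^bold>\<top>\<^bsub>G\<^esub>, \<^bold>\<top>\<^bsub>G\<^esub>)"

text \<open>\<open>X \<Zinj> Y\<close> is the double-headed implication
  \<open>[upper X \<leadsto> lower Y, lower X \<leadsto> upper Y]\<close>, and \<open>X \<Rrightarrow> Y\<close> is the implication that
  induces the relation \<open>X \<lesssim> Y\<close>.\<close>

definition interval_dimp :: "('a, 'b) bci_scheme \<Rightarrow> 'a \<times> 'a \<Rightarrow> 'a \<times> 'a \<Rightarrow> 'a \<times> 'a"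
    (infixr \<open>\<Zinj>\<index>\<close> 65)
  where "X \<Zinj>\<^bsub>G\<^esub> Y = (upper X \<leadsto>\<^bsub>G\<^esub> lower Y, lower X \<leadsto>\<^bsub>G\<^esub> upper Y)"

definition interval_imp :: "('a, 'b) bci_scheme \<Rightarrow> 'a \<times> 'a \<Rightarrow> 'a \<times> 'a \<Rightarrow> 'a \<times> 'a"
    (infixr \<open>\<Rrightarrow>\<index>\<close> 65)
  where "X \<Rrightarrow>\<^bsub>G\<^esub> Y =
    ((lower X \<leadsto>\<^bsub>G\<^esub> lower Y) \<^bold>\<and>\<^bsub>G\<^esub> (upper X \<leadsto>\<^bsub>G\<^esub> upper Y), lower X \<leadsto>\<^bsub>G\<^esub> upper Y)"

definition interval_le :: "('a, 'b) bci_scheme \<Rightarrow> 'a \<times> 'a \<Rightarrow> 'a \<times> 'a \<Rightarrow> bool"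
    (infix \<open>\<lesssim>\<index>\<close> 50)
  where "X \<lesssim>\<^bsub>G\<^esub> Y \<longleftrightarrow> X \<Rrightarrow>\<^bsub>G\<^esub> Y = \<^bold>\<top>\<^bold>\<top>\<^bsub>G\<^esub>"

end

theory Submission
  imports Defs
begin

text \<open>The meet of two elements is \<open>\<^bold>\<top>\<close> only if both are, because \<open>\<^bold>\<top>\<close> is maximal in a
  BCI-algebra. Hence \<open>X \<lesssim> Y\<close> is the endpointwise order, and every claim splits into inequalities
  between endpoints that are laws of BCI-algebras. For the last one, write
  \<open>x \<leadsto> \<^bold>\<top> = x \<leadsto> (y \<leadsto> y) = y \<leadsto> (x \<leadsto> y)\<close> for one direction, and use
  \<open>x \<leadsto> y \<preceq> (y \<leadsto> \<^bold>\<top>) \<leadsto> (x \<leadsto> \<^bold>\<top>) \<preceq> ((x \<leadsto> \<^bold>\<top>) \<leadsto> (y \<leadsto> \<^bold>\<top>)) \<leadsto> \<^bold>\<top>\<close> for the other.\<close>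

context bci_algebra
begin

declare imp_closed [simp, intro] top_closed [simp, intro]

text \<open>Maximality of top: C2 and C3 give \<open>a \<preceq> top \<leadsto> a\<close>, and the
  hypothesis turns the right side into top, so antisymmetry applies.\<close>

lemma top_imp_eq_top:
  assumes "a \<in> carrier G" "\<^bold>\<top> \<leadsto> a = \<^bold>\<top>"
  shows "a = \<^bold>\<top>"
  using C2[of a a] C3[of a] C4[of a "\<^bold>\<top>"] assms by simp

text \<open>One inequality is C2 at \<open>a\<close>, \<open>a\<close>. For the other, C2 puts top
  below \<open>(top \<leadsto> a) \<leadsto> a\<close>, which by maximality equals top.\<close>

lemma top_imp [simp]: "a \<in> carrier G \<Longrightarrow> \<^bold>\<top> \<leadsto> a = a"
  using C2[of a a] C3[of a] C2[of "\<^bold>\<top>" a] top_imp_eq_top[of "(\<^bold>\<top> \<leadsto> a) \<leadsto> a"]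
    C4[of "\<^bold>\<top> \<leadsto> a" a]
  by simp

lemma le_refl [simp]: "x \<in> carrier G \<Longrightarrow> x \<preceq> x"
  by (simp add: bci_le_def C3)

lemma le_antisym: "\<lbrakk>x \<preceq> y; y \<preceq> x; x \<in> carrier G; y \<in> carrier G\<rbrakk> \<Longrightarrow> x = y"
  by (simp add: bci_le_def C4)

text \<open>The premises reduce C1 to
  \<open>top \<leadsto> (top \<leadsto> (x \<leadsto> z)) = top\<close>, and \<open>top_imp\<close>
  strips the leading tops.\<close>

lemma le_trans:
  "\<lbrakk>x \<preceq> y; y \<preceq> z; x \<in> carrier G; y \<in> carrier G; z \<in> carrier G\<rbrakk> \<Longrightarrow> x \<preceq> z"
  using C1[of z x y] by (simp add: bci_le_def)

lemma imp_antitone: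
  "\<lbrakk>y \<preceq> z; x \<in> carrier G; y \<in> carrier G; z \<in> carrier G\<rbrakk> \<Longrightarrow> z \<leadsto> x \<preceq> y \<leadsto> x"
  using C1[of x y z] by (simp add: bci_le_def)

lemma le_imp_imp: "\<lbrakk>x \<in> carrier G; y \<in> carrier G\<rbrakk> \<Longrightarrow> x \<preceq> (x \<leadsto> y) \<leadsto> y"
  by (simp add: bci_le_def C2)

lemma imp_prefixing:
  "\<lbrakk>x \<in> carrier G; y \<in> carrier G; z \<in> carrier G\<rbrakk> \<Longrightarrow> x \<leadsto> y \<preceq> (y \<leadsto> z) \<leadsto> (x \<leadsto> z)"
  by (simp add: bci_le_def C1)

text \<open>Prefix by \<open>z\<close>, then shrink the antecedent
  \<open>(y \<leadsto> z) \<leadsto> z\<close> to the smaller \<open>y\<close>, which enlarges the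
  implication.\<close>

lemma imp_exchange_le:
  assumes "x \<in> carrier G" "y \<in> carrier G" "z \<in> carrier G"
  shows "x \<leadsto> (y \<leadsto> z) \<preceq> y \<leadsto> (x \<leadsto> z)"
proof (rule le_trans)
  show "x \<leadsto> (y \<leadsto> z) \<preceq> ((y \<leadsto> z) \<leadsto> z) \<leadsto> (x \<leadsto> z)"
    using assms by (simp add: imp_prefixing)
  show "((y \<leadsto> z) \<leadsto> z) \<leadsto> (x \<leadsto> z) \<preceq> y \<leadsto> (x \<leadsto> z)"
    using assms by (simp add: imp_antitone le_imp_imp)
qed (use assms in auto)

lemma imp_exchange:
  "\<lbrakk>x \<in> carrier G; y \<in> carrier G; z \<in> carrier G\<rbrakk> \<Longrightarrow> x \<leadsto> (y \<leadsto> z) = y \<leadsto> (x \<leadsto> z)"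
  by (intro le_antisym imp_exchange_le imp_closed)

lemma le_imp_swap:
  "\<lbrakk>x \<preceq> y \<leadsto> z; x \<in> carrier G; y \<in> carrier G; z \<in> carrier G\<rbrakk> \<Longrightarrow> y \<preceq> x \<leadsto> z"
  by (simp add: bci_le_def imp_exchange[of y])

text \<open>Prefixing with its two antecedents exchanged.\<close>

lemma imp_suffixing:
  "\<lbrakk>x \<in> carrier G; y \<in> carrier G; z \<in> carrier G\<rbrakk> \<Longrightarrow> y \<leadsto> z \<preceq> (x \<leadsto> y) \<leadsto> (x \<leadsto> z)"
  by (intro le_imp_swap[of "x \<leadsto> y"] imp_prefixing imp_closed)

lemma imp_monotone:
  "\<lbrakk>y \<preceq> z; x \<in> carrier G; y \<in> carrier G; z \<in> carrier G\<rbrakk> \<Longrightarrow> x \<leadsto> y \<preceq> x \<leadsto> z"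
  using imp_suffixing[of x y z] by (simp add: bci_le_def)

text \<open>The usual collapse for a Galois connection: apply the antitone map
  \<open>_ \<leadsto> y\<close> to \<open>le_imp_imp\<close> at \<open>x\<close>, and use
  \<open>le_imp_imp\<close> at \<open>x \<leadsto> y\<close> for the converse.\<close>

lemma imp_imp_imp:
  assumes "x \<in> carrier G" "y \<in> carrier G"
  shows "((x \<leadsto> y) \<leadsto> y) \<leadsto> y = x \<leadsto> y"
  by (rule le_antisym) (use assms in \<open>simp_all add: imp_antitone le_imp_imp\<close>)

lemma imp_le_converse_imp_top:
  "\<lbrakk>x \<in> carrier G; y \<in> carrier G\<rbrakk> \<Longrightarrow> x \<leadsto> y \<preceq> (y \<leadsto> x) \<leadsto> \<^bold>\<top>"
  using imp_prefixing[of x y x] by (simp add: C3)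

lemma imp_imp_top:
  assumes "x \<in> carrier G" "y \<in> carrier G"
  shows "(x \<leadsto> y) \<leadsto> \<^bold>\<top> = (x \<leadsto> \<^bold>\<top>) \<leadsto> (y \<leadsto> \<^bold>\<top>)"
proof (rule le_antisym)
  have "x \<leadsto> \<^bold>\<top> = y \<leadsto> (x \<leadsto> y)"
    using assms imp_exchange[of x y y] by (simp add: C3)
  \<comment> \<open>After rewriting \<open>x \<leadsto> top\<close>, this is suffixing with
    \<open>y\<close> as the common antecedent.\<close>
  then show "(x \<leadsto> y) \<leadsto> \<^bold>\<top> \<preceq> (x \<leadsto> \<^bold>\<top>) \<leadsto> (y \<leadsto> \<^bold>\<top>)"
    using assms by (simp add: imp_suffixing)
  have "x \<leadsto> y \<preceq> ((x \<leadsto> \<^bold>\<top>) \<leadsto> (y \<leadsto> \<^bold>\<top>)) \<leadsto> \<^bold>\<top>"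
  proof (rule le_trans)
    show "x \<leadsto> y \<preceq> (y \<leadsto> \<^bold>\<top>) \<leadsto> (x \<leadsto> \<^bold>\<top>)"
      using assms by (simp add: imp_prefixing)
    show "(y \<leadsto> \<^bold>\<top>) \<leadsto> (x \<leadsto> \<^bold>\<top>) \<preceq> ((x \<leadsto> \<^bold>\<top>) \<leadsto> (y \<leadsto> \<^bold>\<top>)) \<leadsto> \<^bold>\<top>"
      using assms by (simp add: imp_le_converse_imp_top)
  qed (use assms in auto)
  then show "(x \<leadsto> \<^bold>\<top>) \<leadsto> (y \<leadsto> \<^bold>\<top>) \<preceq> (x \<leadsto> y) \<leadsto> \<^bold>\<top>"
    using assms by (simp add: le_imp_swap)
qed (use assms in auto)

text \<open>The endpoints are ordered through the middle term
  \<open>lower X \<leadsto> lower Y\<close>.\<close>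

lemma interval_dimp_closed:
  "\<lbrakk>X \<in> intervals G; Y \<in> intervals G\<rbrakk> \<Longrightarrow> X \<Zinj> Y \<in> intervals G"
  using le_trans[OF imp_antitone[of "lower X" "upper X" "lower Y"]
      imp_monotone[of "lower Y" "upper Y" "lower X"]]
  by (auto simp: intervals_def interval_dimp_def)

lemma degenerate_in_intervals: "u \<in> carrier G \<Longrightarrow> (u, u) \<in> intervals G"
  by (simp add: intervals_def)

end

context meet_bci_algebra
begin

lemma meet_eq_top_iff:
  assumes "a \<in> carrier G" "b \<in> carrier G"
  shows "a \<^bold>\<and> b = \<^bold>\<top> \<longleftrightarrow> a = \<^bold>\<top> \<and> b = \<^bold>\<top>"
proof -
  interpret L: lower_semilattice "bci_order G"
    by (rule meet_semilattice)
  have car: "carrier (bci_order G) = carrier G" and le: "le (bci_order G) = bci_le G"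
    by (simp_all add: bci_order_def)
  \<comment> \<open>The bounds on the meet of top with itself are for the converse direction, where
    antisymmetry identifies that meet with top.\<close>
  have "a \<^bold>\<and> b \<preceq> a" "a \<^bold>\<and> b \<preceq> b" "\<^bold>\<top> \<preceq> \<^bold>\<top> \<^bold>\<and> \<^bold>\<top>" "\<^bold>\<top> \<^bold>\<and> \<^bold>\<top> \<preceq> \<^bold>\<top>" "\<^bold>\<top> \<^bold>\<and> \<^bold>\<top> \<in> carrier G"
    using L.meet_left[of a b] L.meet_right[of a b] L.meet_le[of "\<^bold>\<top>" "\<^bold>\<top>" "\<^bold>\<top>"]
      L.meet_left[of "\<^bold>\<top>" "\<^bold>\<top>"] L.meet_closed[of "\<^bold>\<top>" "\<^bold>\<top>"] assms
    by (simp_all add: bci_meet_def car le)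
  then show ?thesis
    using assms le_antisym[of "\<^bold>\<top> \<^bold>\<and> \<^bold>\<top>" "\<^bold>\<top>"] by (auto simp: bci_le_def)
qed

lemma interval_le_iff:
  assumes "X \<in> intervals G" "Y \<in> intervals G"
  shows "X \<lesssim> Y \<longleftrightarrow> lower X \<preceq> lower Y \<and> upper X \<preceq> upper Y"
proof -
  have X: "lower X \<in> carrier G" "upper X \<in> carrier G" "lower X \<preceq> upper X"
    and Y: "lower Y \<in> carrier G" "upper Y \<in> carrier G"
    using assms by (auto simp: intervals_def)
  have "X \<lesssim> Y \<longleftrightarrow> lower X \<preceq> lower Y \<and> upper X \<preceq> upper Y \<and> lower X \<preceq> upper Y"
    using X Y by (simp add: interval_le_def interval_imp_def interval_top_def meet_eq_top_iff bci_le_def)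
  \<comment> \<open>Since \<open>X\<close> is an interval,
    \<open>lower X \<preceq> upper X \<preceq> upper Y\<close>.\<close>
  also have "\<dots> \<longleftrightarrow> lower X \<preceq> lower Y \<and> upper X \<preceq> upper Y"
    using X Y le_trans[of "lower X" "upper X" "upper Y"] by blast
  finally show ?thesis .
qed

end

theorem theorem4:
  fixes G :: "('a, 'b) bci_scheme" (structure)
    and X Y Z :: "'a \<times> 'a" and u w :: 'a
  assumes "meet_bci_algebra G"
    and "X \<in> intervals G" and "Y \<in> intervals G" and "Z \<in> intervals G"
    and "u \<in> carrier G" and "w \<in> carrier G"
  shows
    "(\<^bold>\<top>\<^bold>\<top> \<lesssim> X \<longrightarrow> X = \<^bold>\<top>\<^bold>\<top>) \<and>
     (X \<lesssim> Y \<longrightarrow> (Y \<Zinj> Z) \<lesssim> (X \<Zinj> Z)) \<and>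
     (X \<lesssim> Y \<longrightarrow> (Z \<Zinj> X) \<lesssim> (Z \<Zinj> Y)) \<and>
     (X \<lesssim> Y \<and> Y \<lesssim> Z \<longrightarrow> X \<lesssim> Z) \<and>
     (X \<lesssim> (Y \<Zinj> (w, w)) \<longrightarrow> Y \<lesssim> (X \<Zinj> (w, w))) \<and>
     ((X \<Zinj> Y) \<lesssim> (((w, w) \<Zinj> X) \<Zinj> ((w, w) \<Zinj> Y))) \<and>
     (((Y \<Zinj> (u, u)) \<Zinj> (u, u)) \<Zinj> (u, u) = Y \<Zinj> (u, u)) \<and>
     ((X \<Zinj> Y) \<lesssim> ((Y \<Zinj> X) \<Zinj> \<^bold>\<top>\<^bold>\<top>)) \<and>
     ((X \<Zinj> Y) \<Zinj> \<^bold>\<top>\<^bold>\<top> = (X \<Zinj> \<^bold>\<top>\<^bold>\<top>) \<Zinj> (Y \<Zinj> \<^bold>\<top>\<^bold>\<top>))"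
proof -
  interpret meet_bci_algebra G by fact
  have car: "lower X \<in> carrier G" "upper X \<in> carrier G" "lower Y \<in> carrier G"
      "upper Y \<in> carrier G" "lower Z \<in> carrier G" "upper Z \<in> carrier G"
      "u \<in> carrier G" "w \<in> carrier G"
    using assms by (auto simp: intervals_def)
  have ivl: "\<^bold>\<top>\<^bold>\<top> \<in> intervals G" "(w, w) \<in> intervals G"
    using assms by (simp_all add: interval_top_def degenerate_in_intervals)
  note le_iff = interval_le_iff interval_dimp_closed ivl assms(2-4)
  note endpoints = interval_dimp_def interval_top_def
  show ?thesis
  proof (intro conjI impI)
    show "X = \<^bold>\<top>\<^bold>\<top>" if "\<^bold>\<top>\<^bold>\<top> \<lesssim> X"
      using that car by (simp add: le_iff) (simp add: endpoints bci_le_def prod_eq_iff)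
    \<comment> \<open>The first \<open>simp\<close> keeps \<open>\<Zinj>\<close> folded, so that
      \<open>interval_dimp_closed\<close> discharges the premises of \<open>interval_le_iff\<close>;
      the second computes the endpoints.\<close>
    show "(Y \<Zinj> Z) \<lesssim> (X \<Zinj> Z)" if "X \<lesssim> Y"
      using that car by (simp add: le_iff) (simp add: endpoints imp_antitone)
    show "(Z \<Zinj> X) \<lesssim> (Z \<Zinj> Y)" if "X \<lesssim> Y"
      using that car by (simp add: le_iff) (simp add: endpoints imp_monotone)
    show "X \<lesssim> Z" if "X \<lesssim> Y \<and> Y \<lesssim> Z"
      using that car le_trans[of "lower X" "lower Y" "lower Z"] le_trans[of "upper X" "upper Y" "upper Z"]
      by (simp add: le_iff)
    \<comment> \<open>Swapping sends the condition on \<open>lower X\<close> to the one on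
      \<open>upper Y\<close>, and that on \<open>upper X\<close> to the one on
      \<open>lower Y\<close>; the consequents agree because both endpoints of the last interval are
      \<open>w\<close>.\<close>
    show "Y \<lesssim> (X \<Zinj> (w, w))" if "X \<lesssim> (Y \<Zinj> (w, w))"
      using that car by (simp add: le_iff) (simp add: endpoints le_imp_swap)
    show "(X \<Zinj> Y) \<lesssim> (((w, w) \<Zinj> X) \<Zinj> ((w, w) \<Zinj> Y))"
      using car by (simp add: le_iff) (simp add: endpoints imp_suffixing)
    \<comment> \<open>Each \<open>\<Zinj> (u, u)\<close> exchanges the roles of the endpoints, so
      three applications leave them placed as one does.\<close>
    show "((Y \<Zinj> (u, u)) \<Zinj> (u, u)) \<Zinj> (u, u) = Y \<Zinj> (u, u)"
      using car by (simp add: endpoints imp_imp_imp)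
    show "(X \<Zinj> Y) \<lesssim> ((Y \<Zinj> X) \<Zinj> \<^bold>\<top>\<^bold>\<top>)"
      using car by (simp add: le_iff) (simp add: endpoints imp_le_converse_imp_top)
    show "(X \<Zinj> Y) \<Zinj> \<^bold>\<top>\<^bold>\<top> = (X \<Zinj> \<^bold>\<top>\<^bold>\<top>) \<Zinj> (Y \<Zinj> \<^bold>\<top>\<^bold>\<top>)"
      using car by (simp add: endpoints imp_imp_top)
  qed
qed

end
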